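(* For every integer $d\ge 2$, the generic $f\in\mathrm{Homeo}([0,1]^d)$ satisfies $\mathcal{H}^d(\operatorname{graph}(f))=\infty$. That is, the set $\{f\in\mathrm{Homeo}([0,1]^d):\mathcal{H}^d(\operatorname{graph}(f))=\infty\}$ is co-meager in $\mathrm{Homeo}([0,1]^d)$.
   Context: $\mathrm{Homeo}([0,1]^d)$ is the group of homeomorphisms of $[0,1]^d$ with the topology of the maximum metric $\max_x|f(x)-g(x)|$ ($|\cdot|$ the Euclidean norm); it is a completely metrizable separable space. A set is meager if it is a countable union of nowhere dense sets, and co-meager if its complement is meager. $\operatorname{graph}(f)=\{(x,f(x)):x\in[0,1]^d\}\subseteq\mathbb{R}^{2d}$. For $A\subseteq\mathbb{R}^m$ and $s\ge0$, $\mathcal{H}^s(A)=\lim_{\delta\downarrow0}\mathcal{H}^s_\delta(A)$ with $\mathcal{H}^s_\delta(A)=\inf\{\sum_{i=1}^\infty(\operatorname{diam}A_i)^s: A\subseteq\bigcup_i A_i,\ \operatorname{diam}A_i\le\delta \text{ for all } i\}$. *)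

theory Defs
  imports "HOL-Analysis.Analysis"
begin

definition nowhere_dense_in :: "'a topology \<Rightarrow> 'a set \<Rightarrow> bool" where
  "nowhere_dense_in X S \<longleftrightarrow> S \<subseteq> topspace X \<and> X interior_of (X closure_of S) = {}"

definition meager_in :: "'a topology \<Rightarrow> 'a set \<Rightarrow> bool" where
  "meager_in X S \<longleftrightarrow> (\<exists>N :: nat \<Rightarrow> 'a set. (\<forall>n. nowhere_dense_in X (N n)) \<and> S = (\<Union>n. N n))"

definition comeager_in :: "'a topology \<Rightarrow> 'a set \<Rightarrow> bool" where
  "comeager_in X S \<longleftrightarrow> S \<subseteq> topspace X \<and> meager_in X (topspace X - S)"

definition unit_cube :: "(real ^ 'n) set" where
  "unit_cube = cbox 0 1"

lemma mem_unit_cube: "x \<in> unit_cube \<longleftrightarrow> (\<forall>i. 0 \<le> x $ i \<and> x $ i \<le> 1)"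
  by (simp add: unit_cube_def mem_box_cart)

(* A homeomorphism of the cube is represented by its unique extension to the whole type
   that is undefined off the cube, so that equality of elements is equality on the cube. *)
definition Homeo_cube :: "(real ^ 'n \<Rightarrow> real ^ 'n) set" where
  "Homeo_cube = {f \<in> extensional unit_cube. \<exists>g. homeomorphism unit_cube unit_cube f g}"

(* The maximum metric; the supremum is attained by compactness of the cube
   (homeo_dist_attained).  The value 0 off Homeo_cube is a dummy: the locale Metric_space
   demands a nonnegative function on the whole type. *)
definition homeo_dist :: "(real ^ 'n \<Rightarrow> real ^ 'n) \<Rightarrow> (real ^ 'n \<Rightarrow> real ^ 'n) \<Rightarrow> real" where
  "homeo_dist f g =
     (if f \<in> Homeo_cube \<and> g \<in> Homeo_cube then SUP x\<in>unit_cube. dist (f x) (g x) else 0)"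

definition Homeo_topology :: "(real ^ 'n \<Rightarrow> real ^ 'n) topology" where
  "Homeo_topology = Metric_space.mtopology Homeo_cube homeo_dist"

(* The product type carries the Euclidean metric, so (real^'n) \<times> (real^'n) is isometric
   to Euclidean space of dimension 2d, d = CARD('n). *)
definition cube_graph :: "(real ^ 'n \<Rightarrow> real ^ 'n) \<Rightarrow> ((real ^ 'n) \<times> (real ^ 'n)) set" where
  "cube_graph f = {(x, f x) | x. x \<in> unit_cube}"

(* The summand (diam A)^s.  The case distinction only concerns s = 0, where the usual
   conventions are diam({})^0 = 0 and 0^0 = 1 for singletons; note 0 powr s = 0 in HOL. *)
definition diam_pow :: "real \<Rightarrow> 'a::metric_space set \<Rightarrow> ennreal" where
  "diam_pow s A = (if A = {} then 0 else if s = 0 then 1 else ennreal (diameter A powr s))"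

(* Boundedness is required explicitly because diameter is unspecified on unbounded sets. *)
definition hausdorff_premeasure :: "real \<Rightarrow> real \<Rightarrow> 'a::metric_space set \<Rightarrow> ennreal" where
  "hausdorff_premeasure s \<delta> E =
     Inf {(\<Sum>i. diam_pow s (A i)) | A :: nat \<Rightarrow> 'a set.
            E \<subseteq> (\<Union>i. A i) \<and> (\<forall>i. bounded (A i) \<and> diameter (A i) \<le> \<delta>)}"

definition hausdorff_measure :: "real \<Rightarrow> 'a::metric_space set \<Rightarrow> ennreal" where
  "hausdorff_measure s E = Lim (at_right 0) (\<lambda>\<delta>. hausdorff_premeasure s \<delta> E)"

lemma hausdorff_premeasure_antimono:
  "\<delta> \<le> \<epsilon> \<Longrightarrow> hausdorff_premeasure s \<epsilon> E \<le> hausdorff_premeasure s \<delta> E"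
  unfolding hausdorff_premeasure_def
  by (intro Inf_superset_mono Collect_mono ex_mono) (auto intro: order_trans)

lemma hausdorff_premeasure_tendsto_SUP:
  "((\<lambda>\<delta>. hausdorff_premeasure s \<delta> E) \<longlongrightarrow> (SUP \<delta>\<in>{0<..}. hausdorff_premeasure s \<delta> E)) (at_right 0)"
proof (rule order_tendstoI)
  fix a assume "a < (SUP \<delta>\<in>{0<..}. hausdorff_premeasure s \<delta> E)"
  then obtain \<delta> where \<delta>: "\<delta> > 0" "a < hausdorff_premeasure s \<delta> E"
    by (auto simp: less_SUP_iff)
  have "\<forall>\<^sub>F \<epsilon> in at_right 0. \<epsilon> < \<delta>"
    using \<delta>(1) by (auto simp: eventually_at_right_field)
  then show "\<forall>\<^sub>F \<epsilon> in at_right 0. a < hausdorff_premeasure s \<epsilon> E"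
  proof eventually_elim
    case (elim \<epsilon>)
    have "hausdorff_premeasure s \<delta> E \<le> hausdorff_premeasure s \<epsilon> E"
      by (rule hausdorff_premeasure_antimono) (use elim in simp)
    with \<delta>(2) show ?case by (rule less_le_trans)
  qed
next
  fix a assume a: "(SUP \<delta>\<in>{0<..}. hausdorff_premeasure s \<delta> E) < a"
  have "\<forall>\<^sub>F \<epsilon> in at_right 0. (0::real) < \<epsilon>"
    by (simp add: eventually_at_right_less)
  then show "\<forall>\<^sub>F \<epsilon> in at_right 0. hausdorff_premeasure s \<epsilon> E < a"
  proof eventually_elim
    case (elim \<epsilon>)
    have "hausdorff_premeasure s \<epsilon> E \<le> (SUP \<delta>\<in>{0<..}. hausdorff_premeasure s \<delta> E)"
      by (rule SUP_upper) (use elim in simp)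
    then show ?case using a by (rule le_less_trans)
  qed
qed

lemma hausdorff_measure_eq_SUP:
  "hausdorff_measure s E = (SUP \<delta>\<in>{0<..}. hausdorff_premeasure s \<delta> E)"
  unfolding hausdorff_measure_def
  by (intro tendsto_Lim hausdorff_premeasure_tendsto_SUP) simp

lemma unit_cube_nonempty: "unit_cube \<noteq> {}"
proof -
  have "0 \<in> (unit_cube :: (real^'n) set)" by (simp add: mem_unit_cube)
  then show ?thesis by blast
qed

lemma homeo_dist_attained:
  assumes "f \<in> Homeo_cube" "g \<in> Homeo_cube"
  shows "\<exists>x\<in>unit_cube. homeo_dist f g = dist (f x) (g x) \<and>
           (\<forall>y\<in>unit_cube. dist (f y) (g y) \<le> dist (f x) (g x))"
proof -
  have "continuous_on unit_cube (\<lambda>x. dist (f x) (g x))"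
    using assms by (auto simp: Homeo_cube_def homeomorphism_def intro!: continuous_intros)
  moreover have "compact (unit_cube :: (real^'a) set)" by (simp add: unit_cube_def)
  ultimately obtain x where x: "x \<in> unit_cube" "\<forall>y\<in>unit_cube. dist (f y) (g y) \<le> dist (f x) (g x)"
    using continuous_attains_sup[OF _ unit_cube_nonempty] by blast
  then have "homeo_dist f g = dist (f x) (g x)"
    using assms by (simp add: homeo_dist_def) (rule cSup_eq_maximum; blast)
  with x show ?thesis by blast
qed

lemma Metric_space_Homeo: "Metric_space Homeo_cube homeo_dist"
proof
  fix f g :: "real^'n \<Rightarrow> real^'n"
  show "0 \<le> homeo_dist f g"
  proof (cases "f \<in> Homeo_cube \<and> g \<in> Homeo_cube")
    case True
    then show ?thesis using homeo_dist_attained[of f g] by fastforce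
  qed (auto simp: homeo_dist_def)
  show "homeo_dist f g = homeo_dist g f"
    by (auto simp: homeo_dist_def dist_commute)
next
  fix f g :: "real^'n \<Rightarrow> real^'n"
  assume fg: "f \<in> Homeo_cube" "g \<in> Homeo_cube"
  show "homeo_dist f g = 0 \<longleftrightarrow> f = g"
  proof
    assume "homeo_dist f g = 0"
    then have "\<And>y. y \<in> unit_cube \<Longrightarrow> f y = g y"
      using homeo_dist_attained[OF fg] by fastforce
    then show "f = g"
      using fg by (auto simp: Homeo_cube_def intro: extensionalityI)
  next
    assume "f = g"
    then show "homeo_dist f g = 0"
      using homeo_dist_attained[OF fg] by auto
  qed
next
  fix f g h :: "real^'n \<Rightarrow> real^'n"
  assume fgh: "f \<in> Homeo_cube" "g \<in> Homeo_cube" "h \<in> Homeo_cube"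
  obtain x where x: "x \<in> unit_cube" "homeo_dist f h = dist (f x) (h x)"
    using homeo_dist_attained fgh by blast
  moreover have "dist (f x) (g x) \<le> homeo_dist f g" "dist (g x) (h x) \<le> homeo_dist g h"
    using homeo_dist_attained[of f g] homeo_dist_attained[of g h] fgh x(1) by auto
  ultimately show "homeo_dist f h \<le> homeo_dist f g + homeo_dist g h"
    using dist_triangle[of "f x" "h x" "g x"] by linarith
qed

lemma topspace_Homeo_topology [simp]: "topspace Homeo_topology = Homeo_cube"
  unfolding Homeo_topology_def
  by (rule Metric_space.topspace_mtopology[OF Metric_space_Homeo])

end

theory Submission
  imports Defs
begin

text \<open>
  Suppose a map \<open>P\<close> into \<open>d\<close>-space that does not increase coordinate differences takes every
  value in a box \<open>Z\<close> at \<open>K\<close> points of the graph that are more than \<open>\<delta>\<close> apart.  In a cover by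
  sets of diameter at most \<open>\<delta>\<close>, the images of at least \<open>K\<close> members then contain each point of
  \<open>Z\<close>, and integrating this count gives \<open>\<H>\<^sup>d \<ge> K vol(Z) / 2\<^sup>d\<close>.  We take
  \<open>P(x, y) = x\<close> with \<open>x\<^sub>k\<close> replaced by \<open>y\<^sub>l\<close>.

  Given a homeomorphism \<open>f\<close>, precompose it with the small homeomorphism
  \<open>x\<^sub>m \<mapsto> x\<^sub>m + s sin\<^sup>2(\<pi> N x\<^sub>k) x\<^sub>m (1 - x\<^sub>m)\<close>, where \<open>k \<noteq> m\<close> (here \<open>d \<ge> 2\<close> enters).  Along
  the \<open>k\<close>-th direction near the centre, some coordinate \<open>f\<^sub>l\<close> then oscillates between two
  values that do not depend on \<open>N\<close>.  By the intermediate value theorem, the multiplicity \<open>K\<close>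
  over a box \<open>Z\<close> independent of \<open>N\<close> is proportional to \<open>N\<close>, and this persists for every map
  within a distance independent of \<open>N\<close>.  Hence \<open>{\<H>\<^sup>d > M}\<close> contains a dense open set for each \<open>M\<close>.
\<close>

section \<open>Volumes of cubes and the multiplicity bound for Hausdorff premeasure\<close>

lemma emeasure_lborel_cbox_content:
  "emeasure lborel (cbox a b) = ennreal (measure lborel (cbox a b))"
  using emeasure_lborel_cbox_finite[of a b] by (intro emeasure_eq_ennreal_measure) simp

lemma emeasure_lborel_cube_cart:
  fixes p :: "real ^ 'n"
  assumes "r \<ge> 0"
  shows "emeasure lborel (cbox (p - vec r) (p + vec r)) = ennreal ((2 * r) ^ CARD('n))"
proof -
  have "cbox (p - vec r) (p + vec r) \<noteq> {}"
    using assms by (simp add: interval_ne_empty_cart)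
  then have "measure lborel (cbox (p - vec r) (p + vec r)) = (2 * r) ^ CARD('n)"
    by (simp add: content_cbox_cart)
  then show ?thesis
    by (simp add: emeasure_lborel_cbox_content)
qed

text \<open>Two points of a fibre cannot share a cover member of diameter at most \<delta>, so
  \<open>z\<close> lies in at least \<open>K\<close> of the images of the members. Since these
  images need not be measurable, they are enlarged to cubes before integrating the count; the
  enlargement costs the factor \<open>2 ^ CARD('n)\<close>.\<close>

lemma hausdorff_premeasure_ge_multiplicity:
  fixes P :: "'a::metric_space \<Rightarrow> real ^ 'n"
  assumes lip: "\<And>a b i. \<bar>P a $ i - P b $ i\<bar> \<le> dist a b"
    and Z: "Z \<in> sets lborel"
    and fibre: "\<And>z. z \<in> Z \<Longrightarrow> \<exists>T\<subseteq>E. finite T \<and> card T = K \<and> (\<forall>t\<in>T. P t = z) \<and>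
                  (\<forall>t\<in>T. \<forall>t'\<in>T. t \<noteq> t' \<longrightarrow> \<delta> < dist t t')"
  shows "of_nat K * emeasure lborel Z / 2 ^ CARD('n) \<le> hausdorff_premeasure (real CARD('n)) \<delta> E"
  unfolding hausdorff_premeasure_def
proof (rule Inf_greatest, clarify)
  fix A :: "nat \<Rightarrow> 'a set"
  assume cover: "E \<subseteq> (\<Union>i. A i)" and A: "\<forall>i. bounded (A i) \<and> diameter (A i) \<le> \<delta>"
  \<comment> \<open>The centre is the image of an arbitrary point of \<open>A i\<close>. The
    diameter suffices as half-side because coordinates of \<open>P\<close> vary by at most the
    distance. An empty member offers no centre and gets the empty set.\<close>
  define C where "C i = (if A i = {} then {} else
    let p = P (SOME a. a \<in> A i); r = vec (diameter (A i)) in cbox (p - r) (p + r))" for i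
  have PC: "P a \<in> C i" if "a \<in> A i" for a i
  proof -
    let ?c = "SOME a. a \<in> A i"
    have c: "?c \<in> A i" using that by (rule someI)
    have *: "\<bar>P a $ j - P ?c $ j\<bar> \<le> diameter (A i)" for j
      using lip[of a j ?c] diameter_bounded_bound[OF _ that c] A by force
    have "P ?c $ j - diameter (A i) \<le> P a $ j \<and> P a $ j \<le> P ?c $ j + diameter (A i)" for j
      using *[of j] by linarith
    then show ?thesis
      using that by (auto simp: C_def Let_def mem_box_cart)
  qed
  have sets_C [measurable]: "C i \<in> sets lborel" for i
    by (simp add: C_def Let_def)
  have vol_C: "emeasure lborel (C i) \<le> 2 ^ CARD('n) * diam_pow (real CARD('n)) (A i)" for i
  proof (cases "A i = {}")
    case False
    have d0: "0 \<le> diameter (A i)"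
      using A by (simp add: diameter_ge_0)
    \<comment> \<open>Diameter 0 is split off because \<open>powr_realpow\<close> needs a positive
      base; both sides are then 0.\<close>
    have "(2 * diameter (A i)) ^ CARD('n) = 2 ^ CARD('n) * diameter (A i) powr real CARD('n)"
      using d0 by (cases "diameter (A i) = 0")
        (simp_all add: power_mult_distrib powr_realpow zero_power)
    then show ?thesis
      using False d0
      by (simp add: C_def Let_def diam_pow_def emeasure_lborel_cube_cart ennreal_mult flip: ennreal_power)
  qed (simp add: C_def)
  have mult: "of_nat K * indicator Z z \<le> (\<Sum>i. indicator (C i) z :: ennreal)" for z
  proof (cases "z \<in> Z")
    case True
    then obtain T where T: "T \<subseteq> E" "finite T" "card T = K" "\<forall>t\<in>T. P t = z"
      and sep: "\<forall>t\<in>T. \<forall>t'\<in>T. t \<noteq> t' \<longrightarrow> \<delta> < dist t t'"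
      using fibre by meson
    have "\<forall>t\<in>T. \<exists>i. t \<in> A i" using T(1) cover by blast
    then obtain \<iota> where \<iota>: "\<And>t. t \<in> T \<Longrightarrow> t \<in> A (\<iota> t)" by metis
    have inj: "inj_on \<iota> T"
    proof (rule inj_onI, rule ccontr)
      fix t t' assume t: "t \<in> T" "t' \<in> T" "\<iota> t = \<iota> t'" "t \<noteq> t'"
      have "dist t t' \<le> diameter (A (\<iota> t))"
        using A \<iota>[OF t(1)] \<iota>[OF t(2)] t(3) by (auto intro: diameter_bounded_bound)
      also have "\<dots> \<le> \<delta>" using A by blast
      finally show False using sep t by force
    qed
    have "of_nat K = (\<Sum>i\<in>\<iota> ` T. 1 :: ennreal)"
      using T(3) by (simp add: card_image[OF inj])
    also have "\<dots> = (\<Sum>i\<in>\<iota> ` T. indicator (C i) z)"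
      using PC \<iota> T(4) by (intro sum.cong refl) (auto simp: indicator_def)
    also have "\<dots> \<le> (\<Sum>i. indicator (C i) z)"
      using T(2) by (intro sum_le_suminf) auto
    finally show ?thesis using True by simp
  qed simp
  have "of_nat K * emeasure lborel Z = (\<integral>\<^sup>+z. of_nat K * indicator Z z \<partial>lborel)"
    using Z by (simp add: nn_integral_cmult_indicator)
  also have "\<dots> \<le> (\<integral>\<^sup>+z. (\<Sum>i. indicator (C i) z) \<partial>lborel)"
    by (intro nn_integral_mono mult)
  also have "\<dots> = (\<Sum>i. emeasure lborel (C i))"
    using sets_C by (subst nn_integral_suminf) auto
  also have "\<dots> \<le> (\<Sum>i. 2 ^ CARD('n) * diam_pow (real CARD('n)) (A i))"
    by (intro suminf_le vol_C summableI)
  also have "\<dots> = 2 ^ CARD('n) * (\<Sum>i. diam_pow (real CARD('n)) (A i))"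
    by (rule ennreal_suminf_cmult)
  finally show "of_nat K * emeasure lborel Z / 2 ^ CARD('n) \<le> (\<Sum>i. diam_pow (real CARD('n)) (A i))"
    by (intro divide_le_posI_ennreal) (simp_all add: zero_less_iff_neq_zero)
qed

section \<open>Shears of the cube, and the projection of the graph\<close>

definition shear :: "'n \<Rightarrow> 'n \<Rightarrow> (real \<Rightarrow> real) \<Rightarrow> real ^ 'n \<Rightarrow> real ^ 'n" where
  "shear k m h x = (\<chi> i. if i = m then x $ m + h (x $ k) * (x $ m * (1 - x $ m)) else x $ i)"

lemma continuous_on_shear:
  assumes "continuous_on UNIV h"
  shows "continuous_on S (shear k m h)"
proof -
  have "continuous_on S (\<lambda>x. h (x $ k))"
    by (rule continuous_on_compose2[OF assms]) (auto intro!: continuous_intros)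
  then have "continuous_on S (\<lambda>x. if i = m then x $ m + h (x $ k) * (x $ m * (1 - x $ m)) else x $ i)" for i
    by (cases "i = m") (auto intro!: continuous_intros)
  then show ?thesis
    unfolding shear_def by (rule continuous_on_vec_lambda)
qed

text \<open>With the other coordinates fixed, the m-th one undergoes t -> t + c t (1 - t) with 0 <=
  c < 1. This fixes 0 and 1 and is strictly increasing on [0,1]. As \<open>k \<noteq> m\<close>, the
  amplitude c = \<open>h (x $ k)\<close> is the same before and after the map. Compactness supplies
  the continuity of the inverse.\<close>

lemma homeomorphism_shear:
  fixes k m :: "'n::finite"
  assumes km: "k \<noteq> m" and cont: "continuous_on UNIV h" and h: "\<And>u. 0 \<le> h u" "\<And>u. h u < 1"
  shows "\<exists>g. homeomorphism unit_cube unit_cube (shear k m h) g"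
proof (rule homeomorphism_compact)
  show "compact (unit_cube :: (real^'n) set)" by (simp add: unit_cube_def)
  show "continuous_on unit_cube (shear k m h)" by (rule continuous_on_shear[OF cont])
  show "inj_on (shear k m h) unit_cube"
  proof (rule inj_onI)
    fix x y :: "real ^ 'n"
    assume x: "x \<in> unit_cube" and y: "y \<in> unit_cube" and eq: "shear k m h x = shear k m h y"
    have other: "x $ i = y $ i" if "i \<noteq> m" for i
      using arg_cong[OF eq, of "\<lambda>v. v $ i"] that by (simp add: shear_def)
    have "x $ m + h (x $ k) * (x $ m * (1 - x $ m)) = y $ m + h (x $ k) * (y $ m * (1 - y $ m))"
      using arg_cong[OF eq, of "\<lambda>v. v $ m"] other[OF km] by (simp add: shear_def)
    then have "(x $ m - y $ m) * (1 + h (x $ k) * (1 - x $ m - y $ m)) = 0"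
      by (simp add: algebra_simps)
    \<comment> \<open>Both m-th coordinates are at most 1, so the bracket is at least -1, and
      \<open>h\<close> stays below 1.\<close>
    moreover have "1 + h (x $ k) * (1 - x $ m - y $ m) > 0"
    proof -
      have "h (x $ k) * (-1) \<le> h (x $ k) * (1 - x $ m - y $ m)"
        using x y h(1) add_mono[of "x $ m" 1 "y $ m" 1]
        by (intro mult_left_mono) (auto simp: mem_unit_cube)
      then show ?thesis using h(2)[of "x $ k"] by linarith
    qed
    ultimately have "x $ m = y $ m" by simp
    with other show "x = y" by (metis vec_eq_iff)
  qed
  show "shear k m h ` unit_cube = unit_cube"
  proof
    show "shear k m h ` unit_cube \<subseteq> unit_cube"
    proof clarify
      fix x :: "real ^ 'n" assume x: "x \<in> unit_cube"
      then have xm: "0 \<le> x $ m" "x $ m \<le> 1" by (auto simp: mem_unit_cube)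
      have "h (x $ k) * (x $ m * (1 - x $ m)) \<le> 1 * (1 * (1 - x $ m))"
        using h xm by (intro mult_mono) (auto simp: less_imp_le)
      moreover have "0 \<le> h (x $ k) * (x $ m * (1 - x $ m))"
        using h xm by simp
      ultimately show "shear k m h x \<in> unit_cube"
        using x xm by (auto simp: mem_unit_cube shear_def)
    qed
    show "unit_cube \<subseteq> shear k m h ` unit_cube"
    proof
      fix y :: "real ^ 'n" assume y: "y \<in> unit_cube"
      have "\<exists>t\<ge>0. t \<le> 1 \<and> t + h (y $ k) * (t * (1 - t)) = y $ m"
        using y by (intro IVT') (auto simp: mem_unit_cube intro!: continuous_intros)
      then obtain t where t: "0 \<le> t" "t \<le> 1" "t + h (y $ k) * (t * (1 - t)) = y $ m" by blast
      define x where "x = (\<chi> i. if i = m then t else y $ i)"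
      have "x \<in> unit_cube" using t y by (auto simp: x_def mem_unit_cube)
      moreover have "shear k m h x = y"
        using t km by (auto simp: shear_def x_def vec_eq_iff)
      ultimately show "y \<in> shear k m h ` unit_cube" by blast
    qed
  qed
qed

lemma dist_shear_le:
  assumes "x \<in> unit_cube" "\<And>u. 0 \<le> h u" "\<And>u. h u \<le> s"
  shows "dist (shear k m h x) x \<le> s"
proof -
  have xm: "0 \<le> x $ m" "x $ m \<le> 1" using assms by (auto simp: mem_unit_cube)
  have "shear k m h x - x = axis m (h (x $ k) * (x $ m * (1 - x $ m)))"
    by (simp add: shear_def axis_def vec_eq_iff)
  also have "\<dots> = (h (x $ k) * (x $ m * (1 - x $ m))) *\<^sub>R axis m 1"
    by (simp add: axis_def vec_eq_iff)
  finally have "dist (shear k m h x) x = h (x $ k) * (x $ m * (1 - x $ m))"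
    using assms xm by (simp add: dist_norm norm_axis_1 abs_of_nonneg)
  also have "\<dots> \<le> s * (1 * 1)"
    using assms xm order_trans[OF assms(2) assms(3)] by (intro mult_mono) auto
  finally show ?thesis by simp
qed

text \<open>A graph point over x projects to z exactly when x agrees with z off the k-th coordinate
  and the l-th value at x equals \<open>z $ k\<close>. A fibre is thus the solution set of one
  scalar equation on a segment in direction \<open>k\<close>.\<close>

definition swap_coord :: "'n \<Rightarrow> 'n \<Rightarrow> (real ^ 'n) \<times> (real ^ 'n) \<Rightarrow> real ^ 'n" where
  "swap_coord k l w = (\<chi> i. if i = k then snd w $ l else fst w $ i)"

lemma swap_coord_lipschitz:
  "\<bar>swap_coord k l a $ i - swap_coord k l b $ i\<bar> \<le> dist a b"
proof -
  have "\<bar>fst a $ i - fst b $ i\<bar> \<le> dist a b" for i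
    using dist_vec_nth_le[of "fst a" i "fst b"] dist_fst_le[of a b] by (simp add: dist_real_def)
  moreover have "\<bar>snd a $ i - snd b $ i\<bar> \<le> dist a b" for i
    using dist_vec_nth_le[of "snd a" i "snd b"] dist_snd_le[of a b] by (simp add: dist_real_def)
  ultimately show ?thesis by (simp add: swap_coord_def)
qed

section \<open>Oscillating perturbations of a cube homeomorphism\<close>

lemma Homeo_cube_restrict_compose:
  assumes "f \<in> Homeo_cube" "homeomorphism unit_cube unit_cube \<phi> \<psi>"
  shows "restrict (f \<circ> \<phi>) unit_cube \<in> Homeo_cube"
proof -
  obtain g where "homeomorphism unit_cube unit_cube f g"
    using assms by (auto simp: Homeo_cube_def)
  then have "homeomorphism unit_cube unit_cube (f \<circ> \<phi>) (\<psi> \<circ> g)"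
    using assms(2) by (rule homeomorphism_compose[rotated])
  then have "homeomorphism unit_cube unit_cube (restrict (f \<circ> \<phi>) unit_cube) (\<psi> \<circ> g)"
    by (rule homeomorphism_cong) auto
  then show ?thesis by (auto simp: Homeo_cube_def)
qed

lemma homeo_dist_ge:
  assumes "f \<in> Homeo_cube" "g \<in> Homeo_cube" "x \<in> unit_cube"
  shows "dist (f x) (g x) \<le> homeo_dist f g"
  using homeo_dist_attained[OF assms(1,2)] assms(3) by auto

lemma homeo_dist_le:
  assumes "f \<in> Homeo_cube" "g \<in> Homeo_cube" "\<And>x. x \<in> unit_cube \<Longrightarrow> dist (f x) (g x) \<le> e"
  shows "homeo_dist f g \<le> e"
  using homeo_dist_attained[OF assms(1,2)] assms(3) by auto

text \<open>Serves oscillations whose end values are known only up to an error \<open>e\<close>,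
  with the order of \<open>A\<close> and \<open>B\<close> unknown. The admissible \<open>v\<close>
  lie between the two end values in either order.\<close>

lemma IVT_between:
  fixes q :: "real \<Rightarrow> real"
  assumes "a \<le> b" "continuous_on {a..b} q" "\<bar>q a - A\<bar> \<le> e" "\<bar>q b - B\<bar> \<le> e"
    and "\<bar>v - (A + B) / 2\<bar> \<le> \<bar>A - B\<bar> / 2 - e"
  shows "\<exists>t\<in>{a..b}. q t = v"
proof (cases "A \<le> B")
  case True
  then have "q a \<le> v" "v \<le> q b" using assms(3-5) by (auto simp: abs_if field_simps split: if_splits)
  then show ?thesis using IVT'[of q a v b] assms by auto
next
  case False
  then have "q b \<le> v" "v \<le> q a" using assms(3-5) by (auto simp: abs_if field_simps split: if_splits)
  then show ?thesis using IVT2'[of q b v a] assms by auto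
qed

text \<open>The order of choices matters: the box and the radius \<gamma>/8 come from
  \<open>f\<close> and \<epsilon> alone, then \<open>K\<close> is chosen from \<open>M\<close> and
  the volume of the box, and finally the frequency \<open>N\<close> from \<open>K\<close> and the
  size of the box.\<close>

lemma dense_hausdorff_measure_graph_gt:
  fixes f :: "real ^ 'n \<Rightarrow> real ^ 'n"
  assumes card: "CARD('n) \<ge> 2" and f: "f \<in> Homeo_cube" and \<epsilon>: "\<epsilon> > 0"
  shows "\<exists>g\<in>Homeo_cube. homeo_dist f g < \<epsilon> \<and>
    (\<exists>r>0. \<forall>g'\<in>Homeo_cube. homeo_dist g g' < r \<longrightarrow>
        of_nat M < hausdorff_measure (real CARD('n)) (cube_graph g'))"
proof -
  obtain k m :: 'n where km: "k \<noteq> m"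
    using card card_le_Suc0_iff_eq[of "UNIV :: 'n set"] by fastforce
  have cont_f: "continuous_on unit_cube f" and inj_f: "inj_on f unit_cube"
    using f by (auto simp: Homeo_cube_def homeomorphism_def intro: inj_on_inverseI)
  have "uniformly_continuous_on unit_cube f"
    using cont_f by (rule compact_uniformly_continuous) (simp add: unit_cube_def)
  then obtain \<delta> where \<delta>: "\<delta> > 0"
      "\<And>x y. x \<in> unit_cube \<Longrightarrow> y \<in> unit_cube \<Longrightarrow> dist x y < \<delta> \<Longrightarrow> dist (f x) (f y) < \<epsilon> / 2"
    unfolding uniformly_continuous_on_def using half_gt_zero[OF \<epsilon>] by (meson dist_commute)
  \<comment> \<open>\<open>s < 1\<close> keeps the shears invertible, and
    \<open>s < \<delta>\<close> keeps the composition close to \<open>f\<close>.\<close>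
  define s where "s = min \<delta> 1 / 2"
  have s: "0 < s" "s < 1" "s < \<delta>" using \<delta> by (auto simp: s_def)
  \<comment> \<open>The constant-amplitude shear that the oscillating one agrees with at the peaks
    of the sine square. It moves the centre by s/4, so by injectivity some coordinate of
    \<open>f\<close> tells the two positions apart.\<close>
  define \<sigma> :: "real ^ 'n \<Rightarrow> real ^ 'n" where "\<sigma> = shear k m (\<lambda>_. s)"
  have \<sigma>_cube: "\<sigma> x \<in> unit_cube" if "x \<in> unit_cube" for x
  proof -
    obtain g where "homeomorphism unit_cube unit_cube \<sigma> g"
      using homeomorphism_shear[OF km, of "\<lambda>_. s"] s by (auto simp: \<sigma>_def)
    then show ?thesis using that by (auto simp: homeomorphism_def)
  qed
  define a :: "real ^ 'n" where "a = vec (1/2)"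
  have a: "a \<in> unit_cube" by (simp add: a_def mem_unit_cube)
  have "\<sigma> a $ m \<noteq> a $ m" using s by (simp add: \<sigma>_def shear_def a_def)
  then have "f (\<sigma> a) \<noteq> f a"
    using inj_f a \<sigma>_cube[OF a] by (metis inj_onD)
  then obtain l where l: "f a $ l \<noteq> f (\<sigma> a) $ l" by (metis vec_eq_iff)
  define A B where "A = f a $ l" and "B = f (\<sigma> a) $ l"
  define \<gamma> where "\<gamma> = \<bar>A - B\<bar>"
  have \<gamma>: "\<gamma> > 0" using l by (simp add: \<gamma>_def A_def B_def)
  have c1: "continuous_on unit_cube (\<lambda>x. f x $ l)"
    by (intro continuous_intros cont_f)
  have c2: "continuous_on unit_cube (\<lambda>x. f (\<sigma> x) $ l)"
    by (rule continuous_on_compose2[OF c1]) (auto simp: \<sigma>_def[symmetric] \<sigma>_cube, simp add: \<sigma>_def continuous_on_shear)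
  obtain \<rho>1 where \<rho>1: "\<rho>1 > 0" "\<And>x. x \<in> unit_cube \<Longrightarrow> dist x a < \<rho>1 \<Longrightarrow> \<bar>f x $ l - A\<bar> < \<gamma> / 8"
    using c1[unfolded continuous_on_iff, rule_format, OF a, of "\<gamma> / 8"] \<gamma> that
    by (auto simp: A_def dist_real_def)
  obtain \<rho>2 where \<rho>2: "\<rho>2 > 0" "\<And>x. x \<in> unit_cube \<Longrightarrow> dist x a < \<rho>2 \<Longrightarrow> \<bar>f (\<sigma> x) $ l - B\<bar> < \<gamma> / 8"
    using c2[unfolded continuous_on_iff, rule_format, OF a, of "\<gamma> / 8"] \<gamma> that
    by (auto simp: B_def dist_real_def)
  \<comment> \<open>The bound 1/2 keeps the box inside the cube; the divisor 2d makes the Euclidean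
    distance to the centre at most half of min(\<rho>1, \<rho>2).\<close>
  define \<rho> where "\<rho> = min (1/2) (min \<rho>1 \<rho>2 / (2 * real CARD('n)))"
  have \<rho>: "\<rho> > 0" "\<rho> \<le> 1/2" using \<rho>1(1) \<rho>2(1) by (auto simp: \<rho>_def)
  have near: "x \<in> unit_cube \<and> \<bar>f x $ l - A\<bar> < \<gamma> / 8 \<and> \<bar>f (\<sigma> x) $ l - B\<bar> < \<gamma> / 8"
    if x: "\<And>i. \<bar>x $ i - 1/2\<bar> \<le> \<rho>" for x
  proof -
    have "0 \<le> x $ i \<and> x $ i \<le> 1" for i using x[of i] \<rho> by linarith
    then have "x \<in> unit_cube" by (simp add: mem_unit_cube)
    moreover have "dist x a < min \<rho>1 \<rho>2"
    proof -
      have "dist x a \<le> (\<Sum>i\<in>UNIV. \<bar>(x - a) $ i\<bar>)" unfolding dist_norm by (rule norm_le_l1_cart)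
      also have "\<dots> \<le> (\<Sum>i\<in>(UNIV::'n set). \<rho>)" using x by (intro sum_mono) (simp add: a_def)
      also have "\<dots> = real CARD('n) * \<rho>" by simp
      also have "\<dots> \<le> real CARD('n) * (min \<rho>1 \<rho>2 / (2 * real CARD('n)))"
        by (intro mult_left_mono) (auto simp: \<rho>_def)
      also have "\<dots> = min \<rho>1 \<rho>2 / 2" by simp
      also have "\<dots> < min \<rho>1 \<rho>2" using \<rho>1(1) \<rho>2(1) by linarith
      finally show ?thesis .
    qed
    ultimately show ?thesis using \<rho>1(2) \<rho>2(2) by simp
  qed
  \<comment> \<open>The k-th side holds target values for the l-th coordinate of the map; the other
    sides hold positions. The half-width \<gamma>/4 is what \<open>IVT_between\<close> leaves when
    the end values carry an error of \<gamma>/4.\<close>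
  define lo hi :: "real ^ 'n"
    where "lo = (\<chi> i. if i = k then (A + B) / 2 - \<gamma> / 4 else 1/2 - \<rho>)"
      and "hi = (\<chi> i. if i = k then (A + B) / 2 + \<gamma> / 4 else 1/2 + \<rho>)"
  define v where "v = measure lborel (cbox lo hi)"
  have lohi: "lo $ i < hi $ i" for i using \<rho> \<gamma> by (simp add: lo_def hi_def)
  have "cbox lo hi \<noteq> {}" using lohi by (simp add: interval_ne_empty_cart less_imp_le)
  then have "v = (\<Prod>i\<in>UNIV. hi $ i - lo $ i)" by (simp add: v_def content_cbox_cart)
  then have v: "v > 0" using lohi by (simp add: prod_pos)
  have emeasure_Z: "emeasure lborel (cbox lo hi) = ennreal v"
    unfolding v_def by (rule emeasure_lborel_cbox_content)
  obtain K :: nat where K: "real M * 2 ^ CARD('n) / v < real K" using reals_Archimedean2 by blast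
  obtain n0 :: nat where n0: "real K / (2 * \<rho>) < real n0" using reals_Archimedean2 by blast
  define n where "n = Suc n0"
  \<comment> \<open>An even frequency makes the centre 1/2 = n/N a zero of the sine.\<close>
  define N where "N = 2 * real n"
  have N: "N > 0" "real K \<le> N * \<rho>"
    using n0 \<rho> by (auto simp: N_def n_def field_simps)
  define h where "h u = s * sin (pi * N * u) ^ 2" for u
  have h: "0 \<le> h u" "h u \<le> s" for u
    using s by (auto simp: h_def abs_square_le_1 intro!: mult_left_le)
  have cont_h: "continuous_on UNIV h" unfolding h_def by (intro continuous_intros)
  obtain \<psi> where \<psi>: "homeomorphism unit_cube unit_cube (shear k m h) \<psi>"
    using homeomorphism_shear[OF km cont_h h(1)] h(2) s(2) le_less_trans by blast
  define g where "g = restrict (f \<circ> shear k m h) unit_cube"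
  have g: "g \<in> Homeo_cube"
    unfolding g_def by (rule Homeo_cube_restrict_compose[OF f \<psi>])
  have \<phi>_cube: "shear k m h x \<in> unit_cube" if "x \<in> unit_cube" for x
    using \<psi> that by (auto simp: homeomorphism_def)
  have "homeo_dist f g \<le> \<epsilon> / 2"
  proof (rule homeo_dist_le[OF f g])
    fix x :: "real ^ 'n" assume x: "x \<in> unit_cube"
    have "dist x (shear k m h x) < \<delta>"
      using dist_shear_le[where h=h and s=s and k=k and m=m, OF x h] s(3) by (simp add: dist_commute)
    then show "dist (f x) (g x) \<le> \<epsilon> / 2"
      using \<delta>(2)[OF x \<phi>_cube[OF x]] x by (simp add: g_def)
  qed
  then have fg: "homeo_dist f g < \<epsilon>" using \<epsilon> by simp
  \<comment> \<open>The radius \<gamma>/8 and the continuity error \<gamma>/8 of \<open>f\<close>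
    near the centre add up to the allowed end error \<gamma>/4.\<close>
  have "of_nat M < hausdorff_measure (real CARD('n)) (cube_graph g')"
    if g': "g' \<in> Homeo_cube" and gg': "homeo_dist g g' < \<gamma> / 8" for g'
  proof -
    have cont_g': "continuous_on unit_cube g'"
      using g' by (auto simp: Homeo_cube_def homeomorphism_def)
    have g'_near: "\<bar>g' x $ l - f (shear k m h x) $ l\<bar> < \<gamma> / 8" if "x \<in> unit_cube" for x
    proof -
      have "\<bar>g' x $ l - g x $ l\<bar> \<le> dist (g x) (g' x)"
        using dist_vec_nth_le[of "g x" l "g' x"] by (simp add: dist_real_def abs_minus_commute)
      then show ?thesis
        using homeo_dist_ge[OF g g' that] gg' that by (simp add: g_def)
    qed
    \<comment> \<open>\<open>u i\<close> is the i-th zero of the sine from 1/2 onwards and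
      \<open>w i\<close> the next peak. The intervals from \<open>u i\<close> to \<open>w i\<close>
      have length 1/(2N) and leave gaps of the same length between them.\<close>
    define u w :: "nat \<Rightarrow> real" where "u i = (real n + real i) / N" and "w i = (real n + real i + 1/2) / N" for i
    have uw: "1/2 \<le> u i" "u i \<le> w i" for i
      using N by (auto simp: u_def w_def N_def field_simps)
    have w_le: "w i \<le> 1/2 + \<rho>" if "i < K" for i
    proof -
      have "real i + 1/2 \<le> N * \<rho>" using that N(2) by linarith
      then have "(real i + 1/2) / N \<le> \<rho>" using N(1) by (simp add: field_simps)
      moreover have "w i = 1/2 + (real i + 1/2) / N" using N(1) by (simp add: w_def N_def field_simps)
      ultimately show ?thesis by simp
    qed
    have h_u: "h (u i) = 0" for i
    proof -
      have "pi * N * u i = real (n + i) * pi" using N by (simp add: u_def)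
      then show ?thesis by (simp only: h_def sin_npi) simp
    qed
    have h_w: "h (w i) = s" for i
    proof -
      have "pi * N * w i = real (n + i) * pi + pi / 2" using N by (simp add: w_def field_simps)
      then have "sin (pi * N * w i) ^ 2 = 1"
        by (simp only: sin_add sin_npi cos_npi) (simp flip: power_mult)
      then show ?thesis by (simp add: h_def)
    qed
    have fibre: "\<exists>T\<subseteq>cube_graph g'. finite T \<and> card T = K \<and> (\<forall>t\<in>T. swap_coord k l t = z) \<and>
                  (\<forall>t\<in>T. \<forall>t'\<in>T. t \<noteq> t' \<longrightarrow> 1 / (4 * N) < dist t t')"
      if z: "z \<in> cbox lo hi" for z
    proof -
      define y where "y t = (\<chi> j. if j = k then t else z $ j)" for t
      have zk: "\<bar>z $ k - (A + B) / 2\<bar> \<le> \<gamma> / 4" and zj: "\<And>j. j \<noteq> k \<Longrightarrow> \<bar>z $ j - 1/2\<bar> \<le> \<rho>"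
      proof -
        have *: "lo $ j \<le> z $ j \<and> z $ j \<le> hi $ j" for j using z by (simp add: mem_box_cart)
        have "(A + B) / 2 - \<gamma> / 4 \<le> z $ k" "z $ k \<le> (A + B) / 2 + \<gamma> / 4"
          using *[of k] by (simp_all add: lo_def hi_def)
        then show "\<bar>z $ k - (A + B) / 2\<bar> \<le> \<gamma> / 4" by linarith
        show "\<bar>z $ j - 1/2\<bar> \<le> \<rho>" if "j \<noteq> k" for j
        proof -
          have "1/2 - \<rho> \<le> z $ j" "z $ j \<le> 1/2 + \<rho>"
            using *[of j] that by (simp_all add: lo_def hi_def)
          then show ?thesis by linarith
        qed
      qed
      have y_near: "\<bar>y t $ j - 1/2\<bar> \<le> \<rho>" if "1/2 \<le> t" "t \<le> 1/2 + \<rho>" for t j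
        using that zj[of j] by (cases "j = k") (simp_all add: y_def)
      have cont_y: "continuous_on S y" for S
        unfolding y_def
      proof (rule continuous_on_vec_lambda)
        show "continuous_on S (\<lambda>t. if j = k then t else z $ j)" for j
          by (cases "j = k") auto
      qed
      \<comment> \<open>One solution per interval: the shear is the identity at \<open>u i\<close>
        and equals \<sigma> at \<open>w i\<close>, so the l-th value runs from near \<open>A\<close>
        to near \<open>B\<close>.\<close>
      have "\<exists>t\<in>{u i..w i}. g' (y t) $ l = z $ k" if i: "i < K" for i
      proof (rule IVT_between)
        have y_cube: "y t \<in> unit_cube" if "t \<in> {u i..w i}" for t
          using near[OF y_near] uw[of i] w_le[OF i] that by simp
        show "u i \<le> w i" by (rule uw)
        show "continuous_on {u i..w i} (\<lambda>t. g' (y t) $ l)"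
          using y_cube
          by (intro continuous_intros continuous_on_compose2[OF cont_g' cont_y]) auto
        have "shear k m h (y (u i)) = y (u i)"
          by (simp add: shear_def vec_eq_iff) (simp add: y_def h_u)
        then have "\<bar>g' (y (u i)) $ l - f (y (u i)) $ l\<bar> < \<gamma> / 8"
          using g'_near[OF y_cube[of "u i"]] uw(2)[of i] by simp
        moreover have "\<bar>f (y (u i)) $ l - A\<bar> < \<gamma> / 8"
          using near[OF y_near[of "u i"]] uw[of i] w_le[OF i] by simp
        ultimately show "\<bar>g' (y (u i)) $ l - A\<bar> \<le> \<gamma> / 4" by linarith
        have "shear k m h (y (w i)) = \<sigma> (y (w i))"
          by (simp add: shear_def \<sigma>_def vec_eq_iff) (simp add: y_def h_w)
        then have "\<bar>g' (y (w i)) $ l - f (\<sigma> (y (w i))) $ l\<bar> < \<gamma> / 8"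
          using g'_near[OF y_cube[of "w i"]] uw(2)[of i] by simp
        moreover have "\<bar>f (\<sigma> (y (w i))) $ l - B\<bar> < \<gamma> / 8"
          using near[OF y_near[of "w i"]] uw[of i] w_le[OF i] by simp
        ultimately show "\<bar>g' (y (w i)) $ l - B\<bar> \<le> \<gamma> / 4" by linarith
        show "\<bar>z $ k - (A + B) / 2\<bar> \<le> \<bar>A - B\<bar> / 2 - \<gamma> / 4"
          using zk by (simp add: \<gamma>_def)
      qed
      then obtain t where t: "\<And>i. i < K \<Longrightarrow> t i \<in> {u i..w i}" "\<And>i. i < K \<Longrightarrow> g' (y (t i)) $ l = z $ k"
        by metis
      define p where "p i = (y (t i), g' (y (t i)))" for i
      \<comment> \<open>The gaps give a distance of at least 1/(2N); halving it yields the strict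
        inequality. The k-th coordinate of the first component alone provides the
        separation.\<close>
      have sep: "1 / (4 * N) < dist (p i) (p j)" if ij: "i < j" "j < K" for i j
      proof -
        have "w i + 1 / (2 * N) = (real n + real i + 1) / N" using N(1) by (simp add: w_def field_simps)
        also have "\<dots> \<le> u j" unfolding u_def using ij N(1) by (intro divide_right_mono) auto
        finally have "w i + 1 / (2 * N) \<le> u j" .
        moreover have "t i \<le> w i" "u j \<le> t j" using t(1)[of i] t(1)[of j] ij by auto
        moreover have "1 / (4 * N) < 1 / (2 * N)" using N(1) by (simp add: field_simps)
        ultimately have "1 / (4 * N) < \<bar>t i - t j\<bar>" by linarith
        also have "\<bar>t i - t j\<bar> = dist (y (t i) $ k) (y (t j) $ k)" by (simp add: y_def dist_real_def)
        also have "\<dots> \<le> dist (y (t i)) (y (t j))" by (rule dist_vec_nth_le)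
        also have "\<dots> \<le> dist (p i) (p j)" using dist_fst_le[of "p i" "p j"] by (simp add: p_def)
        finally show ?thesis .
      qed
      have sep': "1 / (4 * N) < dist (p i) (p j)" if "i \<noteq> j" "i < K" "j < K" for i j
        using sep[of i j] sep[of j i] that by (cases "i < j") (auto simp: dist_commute)
      have "0 < 1 / (4 * N)" using N(1) by simp
      then have "p i \<noteq> p j" if "i \<noteq> j" "i < K" "j < K" for i j
        using sep'[OF that] by auto
      then have "inj_on p {..<K}" by (auto simp: inj_on_def)
      then have "card (p ` {..<K}) = K" by (simp add: card_image)
      moreover have "p ` {..<K} \<subseteq> cube_graph g'"
      proof (rule image_subsetI)
        fix i assume "i \<in> {..<K}"
        then have "y (t i) \<in> unit_cube"
          using near[OF y_near] uw[of i] w_le[of i] t(1)[of i] by simp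
        then show "p i \<in> cube_graph g'" by (simp add: cube_graph_def p_def)
      qed
      moreover have "\<forall>q\<in>p ` {..<K}. swap_coord k l q = z"
        using t(2) by (auto simp: swap_coord_def p_def vec_eq_iff) (simp add: y_def)
      moreover have "\<forall>q\<in>p ` {..<K}. \<forall>q'\<in>p ` {..<K}. q \<noteq> q' \<longrightarrow> 1 / (4 * N) < dist q q'"
      proof (intro ballI impI)
        fix q q' assume "q \<in> p ` {..<K}" "q' \<in> p ` {..<K}" "q \<noteq> q'"
        then obtain i j where "q = p i" "q' = p j" "i < K" "j < K" "i \<noteq> j" by auto
        then show "1 / (4 * N) < dist q q'" by (simp only: sep' not_False_eq_True)
      qed
      ultimately show ?thesis by (intro exI[of _ "p ` {..<K}"]) simp
    qed
    have "real M < real K * v / 2 ^ CARD('n)" using K v by (simp add: field_simps)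
    then have "of_nat M < ennreal (real K * v / 2 ^ CARD('n))"
      by (simp add: ennreal_of_nat_eq_real_of_nat ennreal_less_iff)
    also have "\<dots> = of_nat K * emeasure lborel (cbox lo hi) / 2 ^ CARD('n)"
    proof -
      have "(2::ennreal) ^ CARD('n) = ennreal (2 ^ CARD('n))" by (simp flip: ennreal_power)
      then show ?thesis
        using v by (simp add: emeasure_Z ennreal_of_nat_eq_real_of_nat divide_ennreal flip: ennreal_mult)
    qed
    \<comment> \<open>The single scale 1/(4N) suffices, because the measure is the supremum of the
      premeasures over all scales.\<close>
    also have "\<dots> \<le> hausdorff_premeasure (real CARD('n)) (1 / (4 * N)) (cube_graph g')"
      by (rule hausdorff_premeasure_ge_multiplicity[OF swap_coord_lipschitz _ fibre]) simp
    also have "\<dots> \<le> hausdorff_measure (real CARD('n)) (cube_graph g')"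
      unfolding hausdorff_measure_eq_SUP using N(1) by (intro SUP_upper) simp
    finally show ?thesis .
  qed
  moreover have "\<gamma> / 8 > 0" using \<gamma> by simp
  ultimately show ?thesis using g fg by blast
qed

section \<open>Nowhere density in metric terms, and the category conclusion\<close>

lemma (in Metric_space) nowhere_dense_in_mtopologyI:
  assumes S: "S \<subseteq> M"
    and dense: "\<And>x e. x \<in> M \<Longrightarrow> e > 0 \<Longrightarrow> \<exists>y\<in>M. d x y < e \<and> (\<exists>r>0. \<forall>z\<in>M. d y z < r \<longrightarrow> z \<notin> S)"
  shows "nowhere_dense_in mtopology S"
  unfolding nowhere_dense_in_def
proof
  show "S \<subseteq> topspace mtopology" using S by simp
  show "mtopology interior_of (mtopology closure_of S) = {}"
  proof (rule ccontr)
    assume "mtopology interior_of (mtopology closure_of S) \<noteq> {}"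
    then obtain x where x: "x \<in> mtopology interior_of (mtopology closure_of S)" by blast
    have "openin mtopology (mtopology interior_of (mtopology closure_of S))" by simp
    then obtain e where e: "e > 0" "mball x e \<subseteq> mtopology interior_of (mtopology closure_of S)" and "x \<in> M"
      using x unfolding openin_mtopology by blast
    then obtain y r where y: "y \<in> M" "d x y < e" and r: "r > 0" "\<forall>z\<in>M. d y z < r \<longrightarrow> z \<notin> S"
      using dense[of x e] by blast
    \<comment> \<open>The point \<open>y\<close> lies in the closure of \<open>S\<close>, although a
      whole ball around it misses \<open>S\<close>.\<close>
    have "y \<in> mball x e" using y \<open>x \<in> M\<close> by simp
    then have "y \<in> mtopology closure_of S"
      using e(2) interior_of_subset[of mtopology "mtopology closure_of S"] by (meson subsetD)
    then obtain z where "z \<in> S" "z \<in> mball y r"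
      using r(1) by (auto simp: metric_closure_of)
    then show False using r by simp
  qed
qed

theorem theorem6p2:
  assumes "CARD('n::finite) \<ge> 2"
  shows "comeager_in Homeo_topology
           {f \<in> (Homeo_cube :: (real ^ 'n \<Rightarrow> real ^ 'n) set).
              hausdorff_measure (real CARD('n)) (cube_graph f) = \<infinity>}"
proof -
  define H :: "(real ^ 'n \<Rightarrow> real ^ 'n) \<Rightarrow> ennreal"
    where "H f = hausdorff_measure (real CARD('n)) (cube_graph f)" for f
  \<comment> \<open>Every ball contains the centre of a ball on which \<open>H\<close> exceeds
    \<open>M\<close>, so the sublevel set is nowhere dense without any semicontinuity of
    \<open>H\<close>.\<close>
  have "nowhere_dense_in Homeo_topology {f \<in> Homeo_cube. H f \<le> of_nat M}" for M
    unfolding Homeo_topology_def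
  proof (rule Metric_space.nowhere_dense_in_mtopologyI[OF Metric_space_Homeo])
    fix f :: "real ^ 'n \<Rightarrow> real ^ 'n" and e :: real assume "f \<in> Homeo_cube" "e > 0"
    from dense_hausdorff_measure_graph_gt[OF assms this, of M]
    show "\<exists>g\<in>Homeo_cube. homeo_dist f g < e \<and>
        (\<exists>r>0. \<forall>g'\<in>Homeo_cube. homeo_dist g g' < r \<longrightarrow> g' \<notin> {f \<in> Homeo_cube. H f \<le> of_nat M})"
      unfolding H_def by (simp add: not_le)
  qed simp
  moreover have "Homeo_cube - {f \<in> Homeo_cube. H f = \<infinity>} = (\<Union>M. {f \<in> Homeo_cube. H f \<le> of_nat M})"
  proof -
    \<comment> \<open>Finite values in \<open>ennreal\<close> are those bounded by a natural number,
      which makes the union countable.\<close>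
    have "H f \<noteq> \<infinity> \<longleftrightarrow> (\<exists>M. H f \<le> of_nat M)" for f
      using ennreal_Ex_less_of_nat[of "H f"]
      by (auto simp: less_top intro: less_imp_le le_less_trans[OF _ of_nat_less_top])
    then show ?thesis by blast
  qed
  ultimately have "meager_in Homeo_topology (Homeo_cube - {f \<in> Homeo_cube. H f = \<infinity>})"
    unfolding meager_in_def by (intro exI[of _ "\<lambda>M. {f \<in> Homeo_cube. H f \<le> of_nat M}"]) simp
  then show ?thesis
    unfolding comeager_in_def topspace_Homeo_topology H_def by blast
qed

end
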